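(* Let $A$ be an infinite sequence of rectangles $A_1,A_2,\dots$, with $A_i$ of size $w_i\times l_i$ ($w_i,l_i>0$), such that $\sum_{i=1}^\infty l_i^2<\infty$, $w_i\le l_i$ for all $i$, and $l_{i+1}\le l_i$ for all $i$. For $n\ge1$ let $A^n$ denote the finite set of the first $n$ rectangles $A_1,\dots,A_n$. Then $\eta_0(A)$ is well-defined (that is, $A$ admits a positioning with finite bounding area, so $\eta_0(A)$ is a real number), and $\eta_0(A^n)\to\eta_0(A)$ as $n\to\infty$.
   Context: A positioning of a (finite or countably infinite) family of rectangles $A_i$ of size $w_i\times l_i$ (ordered pairs) is a placement of them in the plane with pairwise disjoint interiors, sides parallel to the coordinate axes, and the side of $A_i$ of length $w_i$ parallel to the $x$-axis. If $A_i$ has lower left corner $(x_i^-,y_i^-)$ and upper right corner $(x_i^+,y_i^+)$, set $p(A_M)=\sup_{i,j}(x_i^+-x_j^-)$, $q(A_M)=\sup_{i,j}(y_i^+-y_j^-)$, bounding area $T(A_M)=p(A_M)q(A_M)$, total area $S(A)=\sum_i w_il_i$, and packing efficiency $\eta(A_M)=S(A)/T(A_M)$ (defined only when these quantities are finite). The best packing efficiency is $\eta_0(A)=\sup\eta(A_M)$ over positionings $A_M$ of $A$ for which $\eta(A_M)$ is defined; $\eta_0$ is regarded as undefined if there is no such positioning. *)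

theory Defs
  imports "HOL-Analysis.Analysis"
begin

text \<open>
  A family of rectangles is an index set \<open>I\<close> with side lengths \<open>w\<close>, \<open>l\<close>; it may be finite or
  infinite. A placement is given by the coordinates \<open>x\<close>, \<open>y\<close> of the lower left corners, the
  rectangles being axis-parallel and not rotatable.
\<close>

definition placed_rect ::
    "('i \<Rightarrow> real) \<Rightarrow> ('i \<Rightarrow> real) \<Rightarrow> ('i \<Rightarrow> real) \<Rightarrow> ('i \<Rightarrow> real) \<Rightarrow> 'i \<Rightarrow> (real \<times> real) set" where
  "placed_rect w l x y i = {x i .. x i + w i} \<times> {y i .. y i + l i}"

definition positioning ::
    "'i set \<Rightarrow> ('i \<Rightarrow> real) \<Rightarrow> ('i \<Rightarrow> real) \<Rightarrow> ('i \<Rightarrow> real) \<Rightarrow> ('i \<Rightarrow> real) \<Rightarrow> bool" where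
  "positioning I w l x y \<longleftrightarrow>
     pairwise (\<lambda>i j. interior (placed_rect w l x y i) \<inter> interior (placed_rect w l x y j) = {}) I"

text \<open>
  With \<open>s = w\<close>, \<open>c = x\<close> the following are the differences whose supremum is the width of the
  bounding box, and with \<open>s = l\<close>, \<open>c = y\<close> those for the height.
\<close>

definition spreads :: "'i set \<Rightarrow> ('i \<Rightarrow> real) \<Rightarrow> ('i \<Rightarrow> real) \<Rightarrow> real set" where
  "spreads I s c = (\<lambda>(i, j). (c i + s i) - c j) ` (I \<times> I)"

definition extent :: "'i set \<Rightarrow> ('i \<Rightarrow> real) \<Rightarrow> ('i \<Rightarrow> real) \<Rightarrow> real" where
  "extent I s c = Sup (spreads I s c)"

definition bounding_area ::
    "'i set \<Rightarrow> ('i \<Rightarrow> real) \<Rightarrow> ('i \<Rightarrow> real) \<Rightarrow> ('i \<Rightarrow> real) \<Rightarrow> ('i \<Rightarrow> real) \<Rightarrow> real" where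
  "bounding_area I w l x y = extent I w x * extent I l y"

definition total_area :: "'i set \<Rightarrow> ('i \<Rightarrow> real) \<Rightarrow> ('i \<Rightarrow> real) \<Rightarrow> real" where
  "total_area I w l = (\<Sum>\<^sub>\<infinity>i\<in>I. w i * l i)"

definition efficiency ::
    "'i set \<Rightarrow> ('i \<Rightarrow> real) \<Rightarrow> ('i \<Rightarrow> real) \<Rightarrow> ('i \<Rightarrow> real) \<Rightarrow> ('i \<Rightarrow> real) \<Rightarrow> real" where
  "efficiency I w l x y = total_area I w l / bounding_area I w l x y"

text \<open>Finiteness of both extents and of the total area.\<close>

definition efficiency_defined ::
    "'i set \<Rightarrow> ('i \<Rightarrow> real) \<Rightarrow> ('i \<Rightarrow> real) \<Rightarrow> ('i \<Rightarrow> real) \<Rightarrow> ('i \<Rightarrow> real) \<Rightarrow> bool" where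
  "efficiency_defined I w l x y \<longleftrightarrow>
     bdd_above (spreads I w x) \<and> bdd_above (spreads I l y) \<and> (\<lambda>i. w i * l i) summable_on I"

definition efficiencies :: "'i set \<Rightarrow> ('i \<Rightarrow> real) \<Rightarrow> ('i \<Rightarrow> real) \<Rightarrow> real set" where
  "efficiencies I w l =
     {efficiency I w l x y | x y. positioning I w l x y \<and> efficiency_defined I w l x y}"

definition best_efficiency :: "'i set \<Rightarrow> ('i \<Rightarrow> real) \<Rightarrow> ('i \<Rightarrow> real) \<Rightarrow> real" where
  "best_efficiency I w l = Sup (efficiencies I w l)"

text \<open>
  Nonemptiness is the existence of a positioning whose efficiency is defined. Boundedness is
  demanded too, so that \<open>Sup\<close> on the reals is the genuine supremum rather than an unspecified value.
\<close>

definition best_efficiency_defined :: "'i set \<Rightarrow> ('i \<Rightarrow> real) \<Rightarrow> ('i \<Rightarrow> real) \<Rightarrow> bool" where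
  "best_efficiency_defined I w l \<longleftrightarrow>
     efficiencies I w l \<noteq> {} \<and> bdd_above (efficiencies I w l)"

end

theory Submission
  imports Defs
begin

text \<open>
  Pack the squares of side \<open>l\<^sub>i\<close>, \<open>i > n\<close>, greedily in columns inside a strip of height \<open>q \<ge> l\<^sub>1\<close>. Every
  column but the last is filled up to the side of the first square of the next column, so a strip
  of width \<open>\<delta>\<^sub>n = l\<^sub>n\<^sub>+\<^sub>1 + (\<Sum>i>n. l\<^sub>i\<^sup>2) / (l\<^sub>1 - l\<^sub>n\<^sub>+\<^sub>1)\<close> suffices, and \<open>\<delta>\<^sub>n\<close> tends to 0. Attaching this strip to
  a bounding box of the first \<open>n\<close> rectangles, whose width is at least \<open>w\<^sub>1\<close>, enlarges its area by a
  factor of at most \<open>1 + \<delta>\<^sub>n / w\<^sub>1\<close>. Conversely, restricting a positioning of \<open>A\<close> to \<open>A\<^sup>n\<close> does not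
  enlarge the bounding area. Hence \<open>(S\<^sub>n / S) \<eta>\<^sub>0(A) \<le> \<eta>\<^sub>0(A\<^sup>n) \<le> (1 + \<delta>\<^sub>n / w\<^sub>1) \<eta>\<^sub>0(A)\<close>.
\<close>

section \<open>Greedy packing of squares into columns\<close>

text \<open>
  The state is the position of the lower left corner of the current square together with the width
  of the current column, which is the side of its first square.
\<close>

fun column_state :: "real \<Rightarrow> (nat \<Rightarrow> real) \<Rightarrow> nat \<Rightarrow> real \<times> real \<times> real" where
  "column_state q s 0 = (0, 0, s 0)"
| "column_state q s (Suc k) =
    (let (x, y, h) = column_state q s k in
     if y + s k + s (Suc k) \<le> q then (x, y + s k, h) else (x + h, 0, s (Suc k)))"

text \<open>The last inequality is an area account. The current column has area at least its filled
  height \<open>y + s k\<close> times its smallest side \<open>s k\<close>. Each finished column has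
  enough area to pay for the width of its successor times \<open>q - s 0\<close>. The first column
  has no predecessor to pay for it, so its width \<open>s 0\<close> is subtracted.\<close>

lemma column_state_invariant:
  fixes s :: "nat \<Rightarrow> real"
  assumes "decseq s" and s0: "\<And>k. 0 \<le> s k" and "s 0 < q"
  shows "case column_state q s k of (x, y, h) \<Rightarrow>
    0 \<le> x \<and> 0 \<le> y \<and> y + s k \<le> q \<and> s k \<le> h \<and>
    (x + h - s 0) * (q - s 0) + (y + s k) * s k \<le> (\<Sum>i\<le>k. (s i)\<^sup>2)"
proof (induction k)
  case 0
  then show ?case using assms by (auto simp: power2_eq_square)
next
  case (Suc k)
  obtain x y h where st: "column_state q s k = (x, y, h)" by (cases "column_state q s k")
  have IH: "0 \<le> x" "0 \<le> y" "y + s k \<le> q" "s k \<le> h"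
    "(x + h - s 0) * (q - s 0) + (y + s k) * s k \<le> (\<Sum>i\<le>k. (s i)\<^sup>2)"
    using Suc st by auto
  have le: "s (Suc k) \<le> s k" "s (Suc k) \<le> s 0"
    using \<open>decseq s\<close> by (auto simp: decseq_def)
  show ?case
  proof (cases "y + s k + s (Suc k) \<le> q")
    case True
    \<comment> \<open>The smallest side of the column drops to \<open>s (Suc k)\<close>, which only
      lowers the estimate for the squares already stacked.\<close>
    have "(y + s k) * s (Suc k) \<le> (y + s k) * s k"
      using le IH s0[of k] by (intro mult_left_mono) auto
    with True st IH le s0[of k] s0[of "Suc k"] show ?thesis
      by (auto simp: power2_eq_square algebra_simps)
  next
    case False
    \<comment> \<open>As the new square does not fit, the old column is filled beyond
      \<open>q - s (Suc k) \<ge> q - s 0\<close>, with sides at least \<open>s (Suc k)\<close>: its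
      share of the account pays for the new column.\<close>
    have "(q - s 0) * s (Suc k) \<le> (y + s k) * s k"
      using le False IH s0[of k] s0[of "Suc k"] by (intro mult_mono) auto
    with False st IH le s0[of k] s0[of "Suc k"] \<open>s 0 < q\<close> show ?thesis
      by (auto simp: power2_eq_square algebra_simps)
  qed
qed

text \<open>The bound \<open>x + s j \<le> x' + h'\<close> serves the induction: when a new column
  starts at \<open>x' + h'\<close>, vertical separation is lost and this bound becomes horizontal
  separation.\<close>

lemma column_state_separated:
  fixes s :: "nat \<Rightarrow> real"
  assumes "decseq s" and s0: "\<And>k. 0 \<le> s k" and "s 0 < q" and "j < k"
  shows "case column_state q s j of (x, y, h) \<Rightarrow> case column_state q s k of (x', y', h') \<Rightarrow>
    x + s j \<le> x' \<or> y + s j \<le> y' \<and> x + s j \<le> x' + h'"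
  using \<open>j < k\<close>
proof (induction k)
  case (Suc k)
  obtain x y h where k: "column_state q s k = (x, y, h)" by (cases "column_state q s k")
  obtain x' y' h' where j: "column_state q s j = (x', y', h')" by (cases "column_state q s j")
  have inv: "0 \<le> x \<and> 0 \<le> y \<and> s k \<le> h"
    using column_state_invariant[OF assms(1-3), of k] k by auto
  show ?case
  proof (cases "j = k")
    case True
    then show ?thesis using k inv s0[of "Suc k"] by (auto simp: Let_def)
  next
    case False
    then show ?thesis using Suc k j inv s0[of k] s0[of "Suc k"]
      by (auto simp: Let_def split: if_splits)
  qed
qed simp

text \<open>Dropping the term of the current column from the invariant bounds the right edge
  \<open>x + h\<close> of every column by the same number, since partial sums stay below the
  series.\<close>

lemma squares_in_strip:
  fixes s :: "nat \<Rightarrow> real"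
  assumes "decseq s" and "\<And>k. 0 \<le> s k" and "s 0 < q" and sm: "summable (\<lambda>k. (s k)\<^sup>2)"
  obtains x y where
    "\<And>k. 0 \<le> x k" "\<And>k. x k + s k \<le> s 0 + (\<Sum>k. (s k)\<^sup>2) / (q - s 0)"
    "\<And>k. 0 \<le> y k" "\<And>k. y k + s k \<le> q"
    "\<And>j k. j < k \<Longrightarrow> x j + s j \<le> x k \<or> y j + s j \<le> y k"
proof
  let ?x = "\<lambda>k. fst (column_state q s k)" and ?y = "\<lambda>k. fst (snd (column_state q s k))"
  fix k
  obtain x y h where st: "column_state q s k = (x, y, h)" by (cases "column_state q s k")
  note inv = column_state_invariant[OF assms(1-3), of k, unfolded st, simplified]
  show "0 \<le> ?x k" "0 \<le> ?y k" "?y k + s k \<le> q" using inv st by auto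
  have "(x + h - s 0) * (q - s 0) \<le> (\<Sum>i\<le>k. (s i)\<^sup>2)"
    using inv assms(2)[of k] mult_nonneg_nonneg[of "y + s k" "s k"] by linarith
  also have "\<dots> \<le> (\<Sum>k. (s k)\<^sup>2)" using sm by (intro sum_le_suminf) auto
  finally have "x + h - s 0 \<le> (\<Sum>k. (s k)\<^sup>2) / (q - s 0)"
    using \<open>s 0 < q\<close> by (simp add: pos_le_divide_eq)
  then show "?x k + s k \<le> s 0 + (\<Sum>k. (s k)\<^sup>2) / (q - s 0)" using inv st by auto
next
  fix j k :: nat assume "j < k"
  from column_state_separated[OF assms(1-3) this]
  show "fst (column_state q s j) + s j \<le> fst (column_state q s k) \<or>
    fst (snd (column_state q s j)) + s j \<le> fst (snd (column_state q s k))"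
    by (auto split: prod.splits)
qed

section \<open>Boxes, extents and bounding areas\<close>

lemma interior_placed_rect:
  "interior (placed_rect w l x y i) = {x i<..<x i + w i} \<times> {y i<..<y i + l i}"
  by (simp add: placed_rect_def interior_Times interior_atLeastAtMost_real)

lemma positioning_subset: "positioning I w l x y \<Longrightarrow> J \<subseteq> I \<Longrightarrow> positioning J w l x y"
  unfolding positioning_def by (rule pairwise_subset)

lemma spreads_boxed:
  assumes "I \<noteq> {}" and "\<And>i. i \<in> I \<Longrightarrow> b \<le> c i" and "\<And>i. i \<in> I \<Longrightarrow> c i + s i \<le> b + e"
  shows "bdd_above (spreads I s c)" and "extent I s c \<le> e"
proof -
  have *: "v \<le> e" if "v \<in> spreads I s c" for v
    using that assms by (force simp: spreads_def)
  then show "bdd_above (spreads I s c)" by (rule bdd_aboveI)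
  have "spreads I s c \<noteq> {}" using \<open>I \<noteq> {}\<close> by (auto simp: spreads_def)
  then show "extent I s c \<le> e" unfolding extent_def using * by (rule cSup_least)
qed

text \<open>An extent only records differences, so the location of an enclosing interval has to be
  recovered from the coordinates.\<close>

lemma extent_box:
  assumes "I \<noteq> {}" and "bdd_above (spreads I s c)"
  obtains b where "\<And>i. i \<in> I \<Longrightarrow> b \<le> c i" and "\<And>i. i \<in> I \<Longrightarrow> c i + s i \<le> b + extent I s c"
proof
  have *: "c i + s i - c j \<le> extent I s c" if "i \<in> I" "j \<in> I" for i j
    unfolding extent_def using assms(2) that by (intro cSup_upper) (auto simp: spreads_def)
  \<comment> \<open>This is the right end of the interval; the witness for \<open>b\<close> is
    \<open>?t - extent I s c\<close>.\<close>
  let ?t = "Sup ((\<lambda>i. c i + s i) ` I)"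
  obtain k where k: "k \<in> I" using assms(1) by blast
  have "c i + s i \<le> c k + extent I s c" if "i \<in> I" for i
    using *[OF that k] by simp
  then have bdd: "bdd_above ((\<lambda>i. c i + s i) ` I)" by (rule bdd_aboveI2)
  fix j assume j: "j \<in> I"
  have "?t \<le> c j + extent I s c"
    using assms(1) *[OF _ j] by (intro cSUP_least) (auto simp: algebra_simps)
  then show "?t - extent I s c \<le> c j" by simp
  show "c j + s j \<le> ?t - extent I s c + extent I s c"
    using cSUP_upper[OF j bdd] by simp
qed

lemma extent_ge:
  assumes "bdd_above (spreads I s c)" and "i \<in> I"
  shows "s i \<le> extent I s c"
proof -
  have "c i + s i - c i \<le> extent I s c"
    unfolding extent_def using assms by (intro cSup_upper) (force simp: spreads_def)+
  then show ?thesis by simp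
qed

lemma extent_subset:
  assumes "bdd_above (spreads I s c)" and "J \<subseteq> I" and "J \<noteq> {}"
  shows "bdd_above (spreads J s c)" and "extent J s c \<le> extent I s c"
proof -
  have sub: "spreads J s c \<subseteq> spreads I s c" using assms(2) by (auto simp: spreads_def)
  then show "bdd_above (spreads J s c)" using assms(1) by (rule bdd_above_mono[rotated])
  show "extent J s c \<le> extent I s c"
    unfolding extent_def using assms sub by (intro cSup_subset_mono) (auto simp: spreads_def)
qed

lemma bounding_area_ge:
  assumes "efficiency_defined I w l x y" and "i \<in> I" and "0 \<le> w i" and "0 \<le> l i"
  shows "w i * l i \<le> bounding_area I w l x y"
  unfolding bounding_area_def using assms extent_ge[of I w x i] extent_ge[of I l y i]
  by (intro mult_mono) (auto simp: efficiency_defined_def)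

text \<open>One rectangle of positive area keeps all bounding areas away from 0.\<close>

lemma bdd_above_efficiencies:
  assumes "i \<in> I" and "0 < w i" and "0 < l i" and "0 \<le> total_area I w l"
  shows "bdd_above (efficiencies I w l)"
proof (rule bdd_aboveI)
  fix e assume "e \<in> efficiencies I w l"
  then obtain x y where e: "e = efficiency I w l x y" and "efficiency_defined I w l x y"
    by (auto simp: efficiencies_def)
  then have "w i * l i \<le> bounding_area I w l x y"
    using bounding_area_ge assms by (metis less_imp_le)
  moreover from this have "0 < bounding_area I w l x y"
    using assms mult_pos_pos by (metis less_le_trans)
  ultimately show "e \<le> total_area I w l / (w i * l i)"
    unfolding e efficiency_def using assms by (intro divide_left_mono mult_pos_pos) auto
qed

lemma efficiency_defined_subset:
  assumes "efficiency_defined I w l x y" and "J \<subseteq> I" and "J \<noteq> {}"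
  shows "efficiency_defined J w l x y"
  using assms extent_subset summable_on_subset_banach
  unfolding efficiency_defined_def by metis

text \<open>The rectangle \<open>i\<close> makes the extents nonnegative, so that the two
  inequalities between extents can be multiplied.\<close>

lemma bounding_area_subset:
  assumes "efficiency_defined I w l x y" and "J \<subseteq> I" and "i \<in> J" and "0 \<le> w i" and "0 \<le> l i"
  shows "bounding_area J w l x y \<le> bounding_area I w l x y"
proof -
  have b: "bdd_above (spreads I w x)" "bdd_above (spreads I l y)" and J: "J \<noteq> {}" "i \<in> I"
    using assms by (auto simp: efficiency_defined_def)
  note sub = extent_subset[OF _ assms(2) J(1)]
  show ?thesis
    unfolding bounding_area_def
    using sub[OF b(1)] sub[OF b(2)] extent_ge[OF sub(1)[OF b(1)] assms(3)] assms(4,5)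
      extent_ge[OF sub(1)[OF b(2)] assms(3)] extent_ge[OF b(1) J(2)]
    by (intro mult_mono) auto
qed

section \<open>Tails of the sequence and the strip that holds them\<close>

locale rectangle_sequence =
  fixes w l :: "nat \<Rightarrow> real"
  assumes w_pos: "\<And>i. i \<ge> 1 \<Longrightarrow> w i > 0"
    and l_pos: "\<And>i. i \<ge> 1 \<Longrightarrow> l i > 0"
    and l_summable_on: "(\<lambda>i. (l i)\<^sup>2) summable_on {1..}"
    and w_le_l: "\<And>i. i \<ge> 1 \<Longrightarrow> w i \<le> l i"
    and l_Suc: "\<And>i. i \<ge> 1 \<Longrightarrow> l (i + 1) \<le> l i"
begin

abbreviation S :: real where "S \<equiv> total_area {1..} w l"
abbreviation S_upto :: "nat \<Rightarrow> real" where "S_upto n \<equiv> total_area {1..n} w l"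

text \<open>Numbered from 0 to match the packing of squares, whereas the rectangles are numbered
  from 1; thus \<open>tail 0 0\<close> is \<open>l 1\<close>.\<close>

definition tail :: "nat \<Rightarrow> nat \<Rightarrow> real" where "tail n k = l (n + 1 + k)"

text \<open>The width bound of \<open>squares_in_strip\<close> for a strip of height
  \<open>q\<close>.\<close>

definition strip_width :: "nat \<Rightarrow> real \<Rightarrow> real" where
  "strip_width n q = tail n 0 + (\<Sum>k. (tail n k)\<^sup>2) / (q - tail n 0)"

lemma decseq_tail: "decseq (tail n)"
  unfolding tail_def decseq_Suc_iff using l_Suc[of "n + 1 + _"] by simp

lemma tail_pos: "0 < tail n k"
  unfolding tail_def by (rule l_pos) simp

lemma summable_tail: "summable (\<lambda>k. (tail n k)\<^sup>2)"
proof -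
  have "(\<lambda>i. (l i)\<^sup>2) summable_on ((\<lambda>k. n + 1 + k) ` UNIV)"
    by (rule summable_on_subset_banach[OF l_summable_on]) auto
  then have "(\<lambda>k. (tail n k)\<^sup>2) summable_on UNIV"
    by (subst (asm) summable_on_reindex) (auto simp: inj_on_def o_def tail_def)
  then show ?thesis by (rule summable_on_UNIV_nonneg_real_iff[THEN iffD1, rotated]) simp
qed

lemma tail_tendsto_0: "(\<lambda>n. tail n 0) \<longlonglongrightarrow> 0"
proof -
  have "(\<lambda>k. (tail 0 k)\<^sup>2) \<longlonglongrightarrow> 0" by (rule summable_LIMSEQ_zero[OF summable_tail])
  then have "(\<lambda>k. sqrt ((tail 0 k)\<^sup>2)) \<longlonglongrightarrow> sqrt 0" by (rule tendsto_real_sqrt)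
  then have "(\<lambda>k. tail 0 k) \<longlonglongrightarrow> 0" by (simp add: abs_of_pos[OF tail_pos])
  then show ?thesis by (simp add: tail_def)
qed

lemma tail_sum_tendsto_0: "(\<lambda>n. \<Sum>k. (tail n k)\<^sup>2) \<longlonglongrightarrow> 0"
proof -
  have eq: "(\<Sum>k. (tail n k)\<^sup>2) = (\<Sum>k. (tail 0 k)\<^sup>2) - (\<Sum>k<n. (tail 0 k)\<^sup>2)" for n
    using suminf_minus_initial_segment[OF summable_tail, of 0 n] by (simp add: tail_def add_ac)
  have "(\<lambda>n. (\<Sum>k. (tail 0 k)\<^sup>2) - (\<Sum>k<n. (tail 0 k)\<^sup>2))
      \<longlonglongrightarrow> (\<Sum>k. (tail 0 k)\<^sup>2) - (\<Sum>k. (tail 0 k)\<^sup>2)"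
    by (intro tendsto_diff tendsto_const summable_LIMSEQ summable_tail)
  then show ?thesis by (subst eq) simp
qed

lemma strip_width_tendsto_0: "(\<lambda>n. strip_width n (l 1)) \<longlonglongrightarrow> 0"
proof -
  have "(\<lambda>n. tail n 0 + (\<Sum>k. (tail n k)\<^sup>2) / (l 1 - tail n 0)) \<longlonglongrightarrow> 0 + 0 / (l 1 - 0)"
    using l_pos[of 1]
    by (intro tendsto_intros tail_tendsto_0 tail_sum_tendsto_0) auto
  then show ?thesis by (simp add: strip_width_def)
qed

lemma strip_width_nonneg: "tail n 0 < q \<Longrightarrow> 0 \<le> strip_width n q"
  unfolding strip_width_def using tail_pos[of n 0] summable_tail
  by (auto intro!: add_nonneg_nonneg divide_nonneg_nonneg suminf_nonneg)

text \<open>Replaces the height of an arbitrary bounding box, which is at least \<open>l 1\<close>,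
  by \<open>l 1\<close>, making the bound independent of the positioning.\<close>

lemma strip_width_antimono:
  "tail n 0 < q \<Longrightarrow> q \<le> q' \<Longrightarrow> strip_width n q' \<le> strip_width n q"
  unfolding strip_width_def using summable_tail
  by (auto intro!: divide_left_mono suminf_nonneg)

text \<open>Since \<open>w i \<le> l i\<close>, each rectangle fits into the lower left corner of
  its square of side \<open>l i\<close>; the whole strip is then moved to
  \<open>(a, b)\<close>.\<close>

lemma tail_in_strip:
  assumes "tail n 0 < q"
  obtains x y where
    "\<And>i. i > n \<Longrightarrow> a \<le> x i" "\<And>i. i > n \<Longrightarrow> x i + w i \<le> a + strip_width n q"
    "\<And>i. i > n \<Longrightarrow> b \<le> y i" "\<And>i. i > n \<Longrightarrow> y i + l i \<le> b + q"
    "\<And>i j. i > n \<Longrightarrow> i < j \<Longrightarrow> x i + w i \<le> x j \<or> y i + l i \<le> y j"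
proof -
  obtain x y where *:
    "\<And>k. 0 \<le> x k" "\<And>k. x k + tail n k \<le> strip_width n q"
    "\<And>k. 0 \<le> y k" "\<And>k. y k + tail n k \<le> q"
    "\<And>j k. j < k \<Longrightarrow> x j + tail n j \<le> x k \<or> y j + tail n j \<le> y k"
    using squares_in_strip[OF decseq_tail less_imp_le[OF tail_pos] assms summable_tail]
    unfolding strip_width_def by blast
  have t: "tail n (i - n - 1) = l i \<and> w i \<le> l i" if "i > n" for i
    using that w_le_l[of i] by (simp add: tail_def)
  show ?thesis
  proof (rule that[of "\<lambda>i. a + x (i - n - 1)" "\<lambda>i. b + y (i - n - 1)"])
    fix i assume i: "i > n"
    show "a \<le> a + x (i - n - 1)" "b \<le> b + y (i - n - 1)" using * by auto
    show "a + x (i - n - 1) + w i \<le> a + strip_width n q" "b + y (i - n - 1) + l i \<le> b + q"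
      using *(2,4)[of "i - n - 1"] t[OF i] by auto
    fix j assume "i < j"
    then have "i - n - 1 < j - n - 1" using i by simp
    from *(5)[OF this] show "a + x (i - n - 1) + w i \<le> a + x (j - n - 1) \<or> b + y (i - n - 1) + l i \<le> b + y (j - n - 1)"
      using t[OF i] by auto
  qed
qed

section \<open>Total areas\<close>

lemma area_summable_on: "(\<lambda>i. w i * l i) summable_on {1..}"
proof (rule summable_on_comparison_test[OF l_summable_on])
  fix i :: nat assume "i \<in> {1..}"
  then show "w i * l i \<le> (l i)\<^sup>2" "0 \<le> w i * l i"
    using w_le_l[of i] w_pos[of i] l_pos[of i] by (auto simp: power2_eq_square)
qed

lemma S_upto_eq: "S_upto n = (\<Sum>i=1..n. w i * l i)"
  by (simp add: total_area_def)

lemma S_upto_pos: "n \<ge> 1 \<Longrightarrow> 0 < S_upto n"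
  unfolding S_upto_eq using w_pos l_pos by (intro sum_pos) auto

lemma S_upto_le: "S_upto n \<le> S"
  unfolding total_area_def using area_summable_on w_pos l_pos
  by (intro infsum_mono_neutral) (auto intro: summable_on_finite less_imp_le)

lemma S_pos: "0 < S"
  using S_upto_pos[of 1] S_upto_le[of 1] by simp

lemma S_upto_tendsto: "S_upto \<longlonglongrightarrow> S"
proof -
  let ?g = "\<lambda>i. if i = 0 then 0 else w i * l i"
  have "((\<lambda>i. w i * l i) has_sum S) {1..}"
    unfolding total_area_def using area_summable_on by (rule has_sum_infsum)
  also have "?this \<longleftrightarrow> (?g has_sum S) UNIV"
    by (rule has_sum_cong_neutral) auto
  finally have "?g sums S" by (rule has_sum_imp_sums)
  then have "(\<lambda>n. \<Sum>i\<le>n. ?g i) \<longlonglongrightarrow> S" by (simp add: sums_def_le)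
  moreover have "(\<Sum>i\<le>n. ?g i) = S_upto n" for n
    unfolding S_upto_eq by (rule sum.mono_neutral_cong_right) auto
  ultimately show ?thesis by simp
qed

section \<open>Existence of the best efficiencies\<close>

lemma positioning_exists: "\<exists>x y. positioning {1..} w l x y \<and> efficiency_defined {1..} w l x y"
proof -
  \<comment> \<open>The strip now holds all rectangles, and its height must strictly exceed the
    largest side \<open>l 1\<close>; doubling is one choice.\<close>
  have "tail 0 0 < 2 * l 1" using l_pos[of 1] by (simp add: tail_def)
  then obtain x y where *:
    "\<And>i. i > 0 \<Longrightarrow> 0 \<le> x i" "\<And>i. i > 0 \<Longrightarrow> x i + w i \<le> 0 + strip_width 0 (2 * l 1)"
    "\<And>i. i > 0 \<Longrightarrow> 0 \<le> y i" "\<And>i. i > 0 \<Longrightarrow> y i + l i \<le> 0 + 2 * l 1"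
    "\<And>i j. i > 0 \<Longrightarrow> i < j \<Longrightarrow> x i + w i \<le> x j \<or> y i + l i \<le> y j"
    using tail_in_strip by blast
  have "positioning {1..} w l x y"
    unfolding positioning_def
  proof (rule pairwiseI)
    fix i j :: nat assume "i \<in> {1..}" "j \<in> {1..}" "i \<noteq> j"
    then show "interior (placed_rect w l x y i) \<inter> interior (placed_rect w l x y j) = {}"
      using *(5)[of i j] *(5)[of j i] by (fastforce simp: interior_placed_rect linorder_neq_iff)
  qed
  moreover have "bdd_above (spreads {1..} w x)"
    using * by (intro spreads_boxed(1)[of _ 0 _ _ "strip_width 0 (2 * l 1)"]) auto
  moreover have "bdd_above (spreads {1..} l y)"
    using * by (intro spreads_boxed(1)[of _ 0 _ _ "2 * l 1"]) auto
  ultimately show ?thesis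
    using area_summable_on unfolding efficiency_defined_def by blast
qed

text \<open>Covers the whole sequence and its initial segments together: a positioning is obtained
  by restriction, and rectangle 1 bounds the efficiencies.\<close>

lemma best_efficiency_is_defined:
  assumes "I \<subseteq> {1..}" and "1 \<in> I"
  shows "best_efficiency_defined I w l"
proof -
  obtain x y where "positioning {1..} w l x y" "efficiency_defined {1..} w l x y"
    using positioning_exists by blast
  then have "positioning I w l x y" "efficiency_defined I w l x y"
    using assms positioning_subset efficiency_defined_subset by blast+
  moreover have "0 \<le> total_area I w l"
    unfolding total_area_def using assms w_pos l_pos
    by (intro infsum_nonneg mult_nonneg_nonneg) (auto intro: less_imp_le)
  then have "bdd_above (efficiencies I w l)"
    using assms w_pos l_pos by (intro bdd_above_efficiencies[of 1]) auto
  ultimately show ?thesis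
    unfolding best_efficiency_defined_def efficiencies_def by blast
qed

lemma best_efficiency_upper:
  assumes "I \<subseteq> {1..}" and "1 \<in> I" and "positioning I w l x y" and "efficiency_defined I w l x y"
  shows "efficiency I w l x y \<le> best_efficiency I w l"
  unfolding best_efficiency_def
  using best_efficiency_is_defined[OF assms(1,2)] assms(3,4)
  by (intro cSup_upper) (auto simp: best_efficiency_defined_def efficiencies_def)

lemma best_efficiency_least:
  assumes "I \<subseteq> {1..}" and "1 \<in> I"
    and "\<And>x y. positioning I w l x y \<Longrightarrow> efficiency_defined I w l x y \<Longrightarrow> efficiency I w l x y \<le> c"
  shows "best_efficiency I w l \<le> c"
  unfolding best_efficiency_def
  using best_efficiency_is_defined[OF assms(1,2)] assms(3)
  by (intro cSup_least) (auto simp: best_efficiency_defined_def efficiencies_def)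

section \<open>Comparison of the finite and infinite families\<close>

text \<open>Restricting a positioning does not enlarge the box, so only the lost area, a factor
  \<open>S_upto n / S\<close>, can reduce the efficiency.\<close>

lemma best_efficiency_le_upto:
  assumes "n \<ge> 1"
  shows "S_upto n / S * best_efficiency {1..} w l \<le> best_efficiency {1..n} w l"
proof -
  have "best_efficiency {1..} w l \<le> best_efficiency {1..n} w l * (S / S_upto n)"
  proof (rule best_efficiency_least)
    fix x y assume xy: "positioning {1..} w l x y" "efficiency_defined {1..} w l x y"
    then have xyn: "positioning {1..n} w l x y" "efficiency_defined {1..n} w l x y"
      using assms by (auto elim: positioning_subset efficiency_defined_subset)
    have "0 < w 1 * l 1" using w_pos[of 1] l_pos[of 1] by simp
    also have "\<dots> \<le> bounding_area {1..n} w l x y"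
      using xyn assms w_pos[of 1] l_pos[of 1] by (intro bounding_area_ge) auto
    finally have pos: "0 < bounding_area {1..n} w l x y" .
    have le: "bounding_area {1..n} w l x y \<le> bounding_area {1..} w l x y"
      using xy assms w_pos[of 1] l_pos[of 1] by (intro bounding_area_subset[of _ _ _ _ _ _ 1]) auto
    have "efficiency {1..} w l x y \<le> S / bounding_area {1..n} w l x y"
      unfolding efficiency_def using pos le S_pos by (intro divide_left_mono) auto
    also have "\<dots> = efficiency {1..n} w l x y * (S / S_upto n)"
      unfolding efficiency_def using S_upto_pos[OF assms] by simp
    also have "\<dots> \<le> best_efficiency {1..n} w l * (S / S_upto n)"
      using xyn assms S_pos S_upto_pos[OF assms]
      by (intro mult_right_mono best_efficiency_upper) auto
    finally show "efficiency {1..} w l x y \<le> best_efficiency {1..n} w l * (S / S_upto n)" .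
  qed auto
  then show ?thesis using S_pos S_upto_pos[OF assms] by (simp add: field_simps)
qed

text \<open>The strip is attached to the right side of the box and has the same height
  \<open>q\<close>, so only the width can grow.\<close>

lemma positioning_extends:
  assumes "n \<ge> 1" and "positioning {1..n} w l x y" and def: "efficiency_defined {1..n} w l x y"
    and "tail n 0 < l 1"
  obtains x' y' where "positioning {1..} w l x' y'" and "efficiency_defined {1..} w l x' y'"
    and "bounding_area {1..} w l x' y' \<le> bounding_area {1..n} w l x y * (1 + strip_width n (l 1) / w 1)"
proof -
  define p q where "p = extent {1..n} w x" and "q = extent {1..n} l y"
  have bdd: "bdd_above (spreads {1..n} w x)" "bdd_above (spreads {1..n} l y)"
    using def by (auto simp: efficiency_defined_def)
  have p: "w 1 \<le> p" and q: "l 1 \<le> q"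
    using extent_ge[OF bdd(1), of 1] extent_ge[OF bdd(2), of 1] \<open>n \<ge> 1\<close> by (auto simp: p_def q_def)
  have ne: "{1..n} \<noteq> {}" using \<open>n \<ge> 1\<close> by auto
  obtain a where a: "\<And>i. i \<in> {1..n} \<Longrightarrow> a \<le> x i" "\<And>i. i \<in> {1..n} \<Longrightarrow> x i + w i \<le> a + p"
    using extent_box[OF ne bdd(1)] unfolding p_def by blast
  obtain b where b: "\<And>i. i \<in> {1..n} \<Longrightarrow> b \<le> y i" "\<And>i. i \<in> {1..n} \<Longrightarrow> y i + l i \<le> b + q"
    using extent_box[OF ne bdd(2)] unfolding q_def by blast
  define d where "d = strip_width n q"
  have tq: "tail n 0 < q" using assms(4) q by simp
  have d: "0 \<le> d" "d \<le> strip_width n (l 1)"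
    using strip_width_nonneg[OF tq] strip_width_antimono[OF assms(4) q] by (auto simp: d_def)
  obtain u v where uv:
    "\<And>i. i > n \<Longrightarrow> a + p \<le> u i" "\<And>i. i > n \<Longrightarrow> u i + w i \<le> a + p + d"
    "\<And>i. i > n \<Longrightarrow> b \<le> v i" "\<And>i. i > n \<Longrightarrow> v i + l i \<le> b + q"
    "\<And>i j. i > n \<Longrightarrow> i < j \<Longrightarrow> u i + w i \<le> u j \<or> v i + l i \<le> v j"
    using tail_in_strip[OF tq, of "a + p" b] unfolding d_def by blast
  define x' y' where "x' i = (if i \<le> n then x i else u i)" and "y' i = (if i \<le> n then y i else v i)" for i
  have disj: "interior (placed_rect w l x' y' i) \<inter> interior (placed_rect w l x' y' j) = {}"
    if "1 \<le> i" "i < j" for i j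
  proof (cases "j \<le> n")
    case True
    then show ?thesis using assms(2) that
      by (auto simp: positioning_def pairwise_def interior_placed_rect x'_def y'_def)
  next
    case False
    \<comment> \<open>For \<open>i \<le> n\<close> the line at \<open>a + p\<close> separates the
      box from the strip; otherwise both rectangles lie in the strip.\<close>
    then have "x' i + w i \<le> x' j \<or> y' i + l i \<le> y' j"
      using that uv(5)[of i j] uv(1)[of j] a(2)[of i] by (auto simp: x'_def y'_def)
    then show ?thesis by (fastforce simp: interior_placed_rect)
  qed
  have "positioning {1..} w l x' y'"
    unfolding positioning_def
  proof (rule pairwiseI)
    fix i j :: nat assume "i \<in> {1..}" "j \<in> {1..}" "i \<noteq> j"
    then show "interior (placed_rect w l x' y' i) \<inter> interior (placed_rect w l x' y' j) = {}"
      using disj[of i j] disj[of j i] by (auto simp: linorder_neq_iff Int_commute)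
  qed
  moreover have X: "bdd_above (spreads {1..} w x')" "extent {1..} w x' \<le> p + d"
  proof -
    have "a \<le> x' i \<and> x' i + w i \<le> a + (p + d)" if "i \<in> {1..}" for i
      using that a[of i] uv(1,2)[of i] d(1) p w_pos[of 1] by (auto simp: x'_def)
    then show "bdd_above (spreads {1..} w x')" "extent {1..} w x' \<le> p + d"
      by (auto intro!: spreads_boxed[of _ a])
  qed
  moreover have Y: "bdd_above (spreads {1..} l y')" "extent {1..} l y' \<le> q"
  proof -
    have "b \<le> y' i \<and> y' i + l i \<le> b + q" if "i \<in> {1..}" for i
      using that b[of i] uv(3,4)[of i] by (auto simp: y'_def)
    then show "bdd_above (spreads {1..} l y')" "extent {1..} l y' \<le> q"
      by (auto intro!: spreads_boxed[of _ b])
  qed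
  ultimately have "positioning {1..} w l x' y'" "efficiency_defined {1..} w l x' y'"
    using area_summable_on by (auto simp: efficiency_defined_def)
  moreover have "bounding_area {1..} w l x' y' \<le> bounding_area {1..n} w l x y * (1 + strip_width n (l 1) / w 1)"
  proof -
    \<comment> \<open>The bound \<open>w 1 \<le> p\<close> turns the added width into a relative
      increase that does not depend on \<open>p\<close>.\<close>
    have "d = w 1 * (d / w 1)" using w_pos[of 1] by simp
    also have "\<dots> \<le> p * (strip_width n (l 1) / w 1)"
      using p d w_pos[of 1] by (intro mult_mono divide_right_mono) auto
    finally have "p + d \<le> p * (1 + strip_width n (l 1) / w 1)" by (simp add: algebra_simps)
    then have "extent {1..} w x' \<le> p * (1 + strip_width n (l 1) / w 1)" using X by simp
    moreover have "0 \<le> extent {1..} l y'" "0 \<le> p"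
      using extent_ge[OF Y(1), of 1] l_pos[of 1] p w_pos[of 1] by auto
    moreover have "0 \<le> 1 + strip_width n (l 1) / w 1" using d w_pos[of 1] by simp
    ultimately have "extent {1..} w x' * extent {1..} l y' \<le> p * (1 + strip_width n (l 1) / w 1) * q"
      using Y by (intro mult_mono) auto
    then show ?thesis by (simp add: bounding_area_def p_def q_def mult_ac)
  qed
  ultimately show ?thesis by (rule that)
qed

text \<open>Extending a positioning costs at most the factor by which the box grows, as the total
  area does not decrease.\<close>

lemma best_efficiency_upto_le:
  assumes "n \<ge> 1" and "tail n 0 < l 1"
  shows "best_efficiency {1..n} w l \<le> best_efficiency {1..} w l * (1 + strip_width n (l 1) / w 1)"
proof (rule best_efficiency_least)
  fix x y assume xy: "positioning {1..n} w l x y" "efficiency_defined {1..n} w l x y"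
  obtain x' y' where xy': "positioning {1..} w l x' y'" "efficiency_defined {1..} w l x' y'"
    and le: "bounding_area {1..} w l x' y' \<le> bounding_area {1..n} w l x y * (1 + strip_width n (l 1) / w 1)"
    using positioning_extends[OF assms(1) xy assms(2)] by blast
  let ?c = "1 + strip_width n (l 1) / w 1"
  have c: "0 < ?c"
    using strip_width_nonneg[OF assms(2)] w_pos[of 1] by (simp add: add_pos_nonneg)
  have "0 < w 1 * l 1" using w_pos[of 1] l_pos[of 1] by simp
  moreover have "w 1 * l 1 \<le> bounding_area {1..n} w l x y"
    using xy assms w_pos[of 1] l_pos[of 1] by (intro bounding_area_ge) auto
  moreover have "w 1 * l 1 \<le> bounding_area {1..} w l x' y'"
    using xy' assms w_pos[of 1] l_pos[of 1] by (intro bounding_area_ge) auto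
  ultimately have pos: "0 < bounding_area {1..n} w l x y" "0 < bounding_area {1..} w l x' y'"
    by linarith+
  have "efficiency {1..n} w l x y \<le> S / bounding_area {1..n} w l x y"
    unfolding efficiency_def using pos S_upto_le by (intro divide_right_mono) auto
  also have "\<dots> = S / (bounding_area {1..n} w l x y * ?c) * ?c" using c by simp
  also have "\<dots> \<le> efficiency {1..} w l x' y' * ?c"
    unfolding efficiency_def using pos c S_pos le
    by (intro mult_right_mono divide_left_mono mult_pos_pos) auto
  also have "\<dots> \<le> best_efficiency {1..} w l * ?c"
    using xy' c by (intro mult_right_mono best_efficiency_upper) auto
  finally show "efficiency {1..n} w l x y \<le> best_efficiency {1..} w l * ?c" .
qed (use assms in auto)

lemma best_efficiency_upto_tendsto:
  "(\<lambda>n. best_efficiency {1..n} w l) \<longlonglongrightarrow> best_efficiency {1..} w l"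
proof (rule tendsto_sandwich)
  show "\<forall>\<^sub>F n in sequentially. S_upto n / S * best_efficiency {1..} w l \<le> best_efficiency {1..n} w l"
    using eventually_ge_at_top[of 1] by eventually_elim (rule best_efficiency_le_upto)
  \<comment> \<open>This may fail for small \<open>n\<close>, when the first sides are equal, so the
    upper bound is only an eventual one.\<close>
  have "\<forall>\<^sub>F n in sequentially. tail n 0 < l 1"
    using order_tendstoD(2)[OF tail_tendsto_0] l_pos[of 1] by simp
  then show "\<forall>\<^sub>F n in sequentially. best_efficiency {1..n} w l
      \<le> best_efficiency {1..} w l * (1 + strip_width n (l 1) / w 1)"
    using eventually_ge_at_top[of 1] by eventually_elim (rule best_efficiency_upto_le)
  have "(\<lambda>n. S_upto n / S * best_efficiency {1..} w l) \<longlonglongrightarrow> S / S * best_efficiency {1..} w l"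
    using S_pos by (intro tendsto_intros S_upto_tendsto) auto
  then show "(\<lambda>n. S_upto n / S * best_efficiency {1..} w l) \<longlonglongrightarrow> best_efficiency {1..} w l"
    using S_pos by simp
  have "(\<lambda>n. best_efficiency {1..} w l * (1 + strip_width n (l 1) / w 1))
      \<longlonglongrightarrow> best_efficiency {1..} w l * (1 + 0 / w 1)"
    using w_pos[of 1] by (intro tendsto_intros strip_width_tendsto_0) auto
  then show "(\<lambda>n. best_efficiency {1..} w l * (1 + strip_width n (l 1) / w 1))
      \<longlonglongrightarrow> best_efficiency {1..} w l"
    by simp
qed

end

theorem theorem2:
  fixes w l :: "nat \<Rightarrow> real"
  assumes "\<And>i. i \<ge> 1 \<Longrightarrow> w i > 0"
    and "\<And>i. i \<ge> 1 \<Longrightarrow> l i > 0"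
    and "(\<lambda>i. (l i)\<^sup>2) summable_on {1..}"
    and "\<And>i. i \<ge> 1 \<Longrightarrow> w i \<le> l i"
    and "\<And>i. i \<ge> 1 \<Longrightarrow> l (i + 1) \<le> l i"
  shows "best_efficiency_defined {1..} w l
    \<and> (\<forall>n\<ge>1. best_efficiency_defined {1..n} w l)
    \<and> (\<lambda>n. best_efficiency {1..n} w l) \<longlonglongrightarrow> best_efficiency {1..} w l"
proof -
  interpret rectangle_sequence w l using assms by unfold_locales
  show ?thesis
    using best_efficiency_is_defined best_efficiency_upto_tendsto by auto
qed

end
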